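(* Let $W$ be a coincidental reflection group acting on $V=\mathbb{C}^n$, with smallest exponent $e_1$ and exponent gap $a$. For $0\le r\le n$ let $$ f_r(W;q,t)= q^{r+a\binom{r}{2}} \begin{bmatrix} n\\ r\end{bmatrix}_{q^a} \frac{(-tq^{e_1};q^a)_{n-r}\,(-tq^{-1};q^{-a})_{r}}{(q^{e_1+1};q^a)_n}, \qquad h_r(W;q,t) = (-tq^{-ar-1})^{n-r} \begin{bmatrix} n\\ r\end{bmatrix}_{q^a}\frac{ (-tq^{-1};q^{-a})_r } { (q^{e_1+1};q^a)_r }. $$ Then $$ \sum_{r=0}^n s^r f_r(W;q,t) = \sum_{r=0}^n (-sq;q^a)_r \cdot h_r(W;q,t). $$
   Context: Notation: $(z;q)_k=(1-z)(1-zq)\cdots(1-zq^{k-1})$ is the $q$-Pochhammer symbol, and $\begin{bmatrix} n\\ r\end{bmatrix}_{q}=\frac{(q;q)_n}{(q;q)_r(q;q)_{n-r}}$ is the $q$-binomial coefficient. The variables $q,t,s$ are indeterminates. A (complex) reflection group is a finite subgroup $W\subset\mathrm{GL}(V)$, $V=\mathbb{C}^n$, generated by reflections (linear transformations whose fixed space is a hyperplane). Its degrees $d_1\le\cdots\le d_n$ are the degrees of homogeneous algebraically independent generators of $S(V^* )^W$; its exponents are $e_i=d_i-1$; its coexponents $e_1^*\le\cdots\le e_n^*$ are the polynomial degrees of a homogeneous basis of the free $S(V^* )^W$-module $(S(V^* )\otimes V)^W$. $W$ is a duality group if $e_i+e^*_{n+1-i}=d_n$ for all $i$. An irreducible duality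 group is coincidental if its exponents form an arithmetic sequence $(e_1,e_1+a,\ldots,e_1+(n-1)a)$ for some positive integer $a$, called the exponent gap. *)

theory Defs
  imports
    "HOL-Analysis.Analysis"
    "HOL-Algebra.Generated_Groups"
    "HOL-Library.Multiset"
    "HOL-Computational_Algebra.Polynomial"
    "HOL-Computational_Algebra.Fraction_Field"
begin

text \<open>
  Throughout, \<open>V = complex ^ 'n\<close>, so that \<open>n = CARD('n)\<close>; linear maps are given by matrices.
\<close>

definition GL :: "(complex ^ 'n ^ 'n) monoid" where
  "GL = \<lparr>carrier = {A. invertible A}, mult = (**), one = mat 1\<rparr>"

lemma group_GL: "group (GL :: (complex ^ 'n ^ 'n) monoid)"
proof (rule groupI)
  fix A :: "complex ^ 'n ^ 'n"
  assume "A \<in> carrier GL"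
  then obtain B where B: "A ** B = mat 1" "B ** A = mat 1"
    by (auto simp: GL_def invertible_def)
  then have "B \<in> carrier GL"
    by (auto simp: GL_def invertible_def)
  with B show "\<exists>B\<in>carrier GL. B \<otimes>\<^bsub>GL\<^esub> A = \<one>\<^bsub>GL\<^esub>"
    by (auto simp: GL_def)
qed (auto simp: GL_def invertible_mult matrix_mul_assoc, auto simp: invertible_def)

definition is_reflection :: "complex ^ 'n ^ 'n \<Rightarrow> bool" where
  "is_reflection g \<longleftrightarrow> g \<in> carrier GL \<and> vec.dim {v. g *v v = v} + 1 = CARD('n)"

definition reflection_group :: "(complex ^ 'n ^ 'n) set \<Rightarrow> bool" where
  "reflection_group W \<longleftrightarrow>
     finite W \<and> subgroup W GL \<and> W = generate GL {g \<in> W. is_reflection g}"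

text \<open>The underlying space is nonzero automatically, since \<open>CARD('n) \<ge> 1\<close>.\<close>

definition irreducible_group :: "(complex ^ 'n ^ 'n) set \<Rightarrow> bool" where
  "irreducible_group W \<longleftrightarrow>
     (\<forall>U. vec.subspace U \<and> (\<forall>g\<in>W. \<forall>u\<in>U. g *v u \<in> U) \<longrightarrow> U = {0} \<or> U = UNIV)"

text \<open>
  The ring \<open>S(V\<^sup>*)\<close> is identified with the ring of polynomial functions on \<open>V\<close>, which is
  legitimate because the complex numbers are infinite. Monomials are indexed by their exponent
  vectors \<open>'n \<Rightarrow> nat\<close>.
\<close>

definition monomial_fun :: "('n \<Rightarrow> nat) \<Rightarrow> complex ^ 'n \<Rightarrow> complex" where
  "monomial_fun \<alpha> v = (\<Prod>i\<in>UNIV. (v $ i) ^ \<alpha> i)"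

definition polynomial_funs :: "(complex ^ 'n \<Rightarrow> complex) set" where
  "polynomial_funs = {p. \<exists>c. finite {\<alpha>. c \<alpha> \<noteq> 0} \<and>
     (\<forall>v. p v = (\<Sum>\<alpha> | c \<alpha> \<noteq> 0. c \<alpha> * monomial_fun \<alpha> v))}"

definition homogeneous_funs :: "nat \<Rightarrow> (complex ^ 'n \<Rightarrow> complex) set" where
  "homogeneous_funs d = {p. \<exists>c.
     \<forall>v. p v = (\<Sum>\<alpha> | (\<Sum>i\<in>UNIV. \<alpha> i) = d. c \<alpha> * monomial_fun \<alpha> v)}"

definition invariants :: "(complex ^ 'n ^ 'n) set \<Rightarrow> (complex ^ 'n \<Rightarrow> complex) set" where
  "invariants W = {p \<in> polynomial_funs. \<forall>g\<in>W. \<forall>v. p (g *v v) = p v}"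

definition algebraically_independent :: "('n \<Rightarrow> complex ^ 'n \<Rightarrow> complex) \<Rightarrow> bool" where
  "algebraically_independent f \<longleftrightarrow>
     (\<forall>P\<in>polynomial_funs. (\<forall>v. P (\<chi> i. f i v) = 0) \<longrightarrow> (\<forall>x. P x = 0))"

definition generate_invariants ::
  "(complex ^ 'n ^ 'n) set \<Rightarrow> ('n \<Rightarrow> complex ^ 'n \<Rightarrow> complex) \<Rightarrow> bool" where
  "generate_invariants W f \<longleftrightarrow>
     (\<forall>i. f i \<in> invariants W) \<and>
     (\<forall>p\<in>invariants W. \<exists>P\<in>polynomial_funs. \<forall>v. p v = P (\<chi> i. f i v))"

text \<open>
  \<open>has_degrees W ds\<close> says that \<open>ds = [d\<^sub>1, \<dots>, d\<^sub>n]\<close> is the increasing list of degrees of \<open>W\<close>.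
  The generators are indexed by the unordered type \<open>'n\<close>, hence the sorting.
\<close>

definition has_degrees :: "(complex ^ 'n ^ 'n) set \<Rightarrow> nat list \<Rightarrow> bool" where
  "has_degrees W ds \<longleftrightarrow> sorted ds \<and>
     (\<exists>f d. (\<forall>i. f i \<in> homogeneous_funs (d i)) \<and>
            algebraically_independent f \<and> generate_invariants W f \<and>
            mset ds = image_mset d (mset_set (UNIV :: 'n set)))"

definition has_exponents :: "(complex ^ 'n ^ 'n) set \<Rightarrow> nat list \<Rightarrow> bool" where
  "has_exponents W es \<longleftrightarrow> has_degrees W (map Suc es)"

text \<open>
  \<open>(S(V\<^sup>*) \<otimes> V)\<^sup>W\<close> is the module of \<open>W\<close>-equivariant polynomial maps \<open>V \<Rightarrow> V\<close>.
\<close>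

definition equivariant_maps ::
  "(complex ^ 'n ^ 'n) set \<Rightarrow> (complex ^ 'n \<Rightarrow> complex ^ 'n) set" where
  "equivariant_maps W = {\<phi>. (\<forall>j. (\<lambda>v. \<phi> v $ j) \<in> polynomial_funs) \<and>
     (\<forall>g\<in>W. \<forall>v. \<phi> (g *v v) = g *v \<phi> v)}"

definition equivariant_basis ::
  "(complex ^ 'n ^ 'n) set \<Rightarrow> ('n \<Rightarrow> complex ^ 'n \<Rightarrow> complex ^ 'n) \<Rightarrow> bool" where
  "equivariant_basis W \<theta> \<longleftrightarrow>
     (\<forall>i. \<theta> i \<in> equivariant_maps W) \<and>
     (\<forall>\<phi>\<in>equivariant_maps W.
        \<exists>!p. (\<forall>i. p i \<in> invariants W) \<and> (\<forall>v. \<phi> v = (\<Sum>i\<in>UNIV. p i v *s \<theta> i v)))"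

definition has_coexponents :: "(complex ^ 'n ^ 'n) set \<Rightarrow> nat list \<Rightarrow> bool" where
  "has_coexponents W cs \<longleftrightarrow> sorted cs \<and>
     (\<exists>\<theta> d. (\<forall>i j. (\<lambda>v. \<theta> i v $ j) \<in> homogeneous_funs (d i)) \<and>
            equivariant_basis W \<theta> \<and>
            mset cs = image_mset d (mset_set (UNIV :: 'n set)))"

text \<open>Lists are indexed from 0, so \<open>es ! i\<close> is \<open>e\<^sub>i\<^sub>+\<^sub>1\<close>.\<close>

definition duality_group :: "(complex ^ 'n ^ 'n) set \<Rightarrow> bool" where
  "duality_group W \<longleftrightarrow> reflection_group W \<and>
     (\<exists>ds es cs. has_degrees W ds \<and> has_exponents W es \<and> has_coexponents W cs \<and>
        (\<forall>i<CARD('n). es ! i + cs ! (CARD('n) - 1 - i) = ds ! (CARD('n) - 1)))"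

definition arithmetic_exponents :: "(complex ^ 'n ^ 'n) set \<Rightarrow> nat \<Rightarrow> nat \<Rightarrow> bool" where
  "arithmetic_exponents W e\<^sub>1 a \<longleftrightarrow>
     a > 0 \<and> has_exponents W (map (\<lambda>i. e\<^sub>1 + i * a) [0..<CARD('n)])"

definition coincidental_group :: "(complex ^ 'n ^ 'n) set \<Rightarrow> bool" where
  "coincidental_group W \<longleftrightarrow>
     irreducible_group W \<and> duality_group W \<and> (\<exists>e\<^sub>1 a. arithmetic_exponents W e\<^sub>1 a)"

definition qpochhammer :: "'k::field \<Rightarrow> 'k \<Rightarrow> nat \<Rightarrow> 'k" where
  "qpochhammer z q k = (\<Prod>i<k. 1 - z * q ^ i)"

definition qbinomial :: "nat \<Rightarrow> nat \<Rightarrow> 'k::field \<Rightarrow> 'k" where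
  "qbinomial n r q = qpochhammer q q n / (qpochhammer q q r * qpochhammer q q (n - r))"

text \<open>These depend on \<open>W\<close> only through \<open>n\<close>, the smallest exponent \<open>e\<^sub>1\<close> and the exponent gap \<open>a\<close>.\<close>

definition f_coeff :: "nat \<Rightarrow> nat \<Rightarrow> nat \<Rightarrow> nat \<Rightarrow> 'k::field \<Rightarrow> 'k \<Rightarrow> 'k" where
  "f_coeff n e\<^sub>1 a r q t =
     q ^ (r + a * (r choose 2)) * qbinomial n r (q ^ a) *
     (qpochhammer (- t * q ^ e\<^sub>1) (q ^ a) (n - r) *
      qpochhammer (- t * q powi (-1)) (q powi (- int a)) r /
      qpochhammer (q ^ (e\<^sub>1 + 1)) (q ^ a) n)"

definition h_coeff :: "nat \<Rightarrow> nat \<Rightarrow> nat \<Rightarrow> nat \<Rightarrow> 'k::field \<Rightarrow> 'k \<Rightarrow> 'k" where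
  "h_coeff n e\<^sub>1 a r q t =
     (- t * q powi (- int a * int r - 1)) ^ (n - r) * qbinomial n r (q ^ a) *
     (qpochhammer (- t * q powi (-1)) (q powi (- int a)) r /
      qpochhammer (q ^ (e\<^sub>1 + 1)) (q ^ a) r)"

text \<open>
  The field of rational functions in three indeterminates, as the fraction field of the iterated
  polynomial ring with variables \<open>q\<close> (innermost), \<open>t\<close> and \<open>s\<close> (outermost).
\<close>

type_synonym ratfun = "rat poly poly poly fract"

definition q_var :: ratfun where "q_var = Fract [:[:[:0, 1:]:]:] 1"
definition t_var :: ratfun where "t_var = Fract [:[:0, 1:]:] 1"
definition s_var :: ratfun where "s_var = Fract [:0, 1:] 1"

end

theory Submission
  imports Defs
begin

text \<open>
  The identity is one of rational functions in \<open>q\<close>, \<open>t\<close>, \<open>s\<close>: it holds in every field in which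
  \<open>q\<close> is nonzero and not a root of unity, for all \<open>n\<close>, \<open>e\<^sub>1\<close> and all \<open>a > 0\<close>
  (\<open>sum_f_coeff_eq_sum_h_coeff\<close>), and the indeterminate \<open>q\<close> has both properties.

  Put \<open>p = q\<^sup>a\<close>, \<open>u = -t/q\<close> and \<open>c = q ^ (e\<^sub>1 + 1)\<close>, so that \<open>-t q ^ e\<^sub>1 = u c\<close>. Expand each
  \<open>(-sq; p)\<^sub>r\<close> on the right in powers of \<open>s\<close> by the \<open>q\<close>-binomial theorem
  (\<open>qpochhammer_eq_sum\<close>) and compare the coefficients of \<open>(sq)\<^sup>k\<close>
  (\<open>sum_qbinomial_qbinomial\<close>). Write \<open>[n, r]\<close> for \<open>qbinomial n r p\<close>. By
  \<open>[n, r] [r, k] = [n, k] [n - k, r - k]\<close> both sides share the factor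
  \<open>p ^ (k choose 2) [n, k] (u; 1/p)\<^sub>k / (c; p)\<^sub>k\<close>. With \<open>m = n - k\<close>, \<open>v = u p ^ (-k)\<close> and
  \<open>d = c p\<^sup>k\<close>, which leaves the product \<open>v d = u c\<close> unchanged, what remains is
    \<open>(v d; p)\<^sub>m / (d; p)\<^sub>m = (\<Sum>j\<le>m. [m, j] (v p ^ (-j)) ^ (m - j) (v; 1/p)\<^sub>j / (d; p)\<^sub>j)\<close>,
  a form of the \<open>q\<close>-Chu-Vandermonde sum. After multiplication by \<open>(d; p)\<^sub>m\<close> it is an identity
  of Laurent polynomials (\<open>q_chu_vandermonde\<close>), and follows by induction on \<open>m\<close> from the
  \<open>q\<close>-Pascal rule.
\<close>

section \<open>Shifted factorials\<close>

lemma qpochhammer_0 [simp]: "qpochhammer z p 0 = 1"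
  by (simp add: qpochhammer_def)

lemma qpochhammer_Suc: "qpochhammer z p (Suc n) = qpochhammer z p n * (1 - z * p ^ n)"
  by (simp add: qpochhammer_def)

lemma qpochhammer_add:
  "qpochhammer z p (m + n) = qpochhammer z p m * qpochhammer (z * p ^ m) p n"
  by (induction n) (simp_all add: qpochhammer_Suc power_add mult_ac)

lemma qpochhammer_Suc_left:
  "qpochhammer z p (Suc n) = (1 - z) * qpochhammer (z * p) p n"
  using qpochhammer_add[of z p 1 n] by (simp add: qpochhammer_Suc)

lemma qpochhammer_nonzero_iff:
  "qpochhammer z p n \<noteq> 0 \<longleftrightarrow> (\<forall>i<n. z * p ^ i \<noteq> 1)"
  by (auto simp: qpochhammer_def)

lemma qpochhammer_self_nonzero:
  assumes "\<And>i. i > 0 \<Longrightarrow> p ^ i \<noteq> 1"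
  shows "qpochhammer p p n \<noteq> 0"
  unfolding qpochhammer_nonzero_iff using assms[of "Suc _"] by simp

section \<open>Gaussian binomial coefficients\<close>

context
  fixes p :: "'k::field"
  assumes p_power_neq_1: "\<And>i. i > 0 \<Longrightarrow> p ^ i \<noteq> 1"
begin

lemma qbinomial_0: "qbinomial n 0 p = 1"
  using qpochhammer_self_nonzero[OF p_power_neq_1] by (simp add: qbinomial_def)

lemma qbinomial_self: "qbinomial n n p = 1"
  using qpochhammer_self_nonzero[OF p_power_neq_1] by (simp add: qbinomial_def)

lemma qbinomial_Suc_Suc:
  assumes "k < n"
  shows "qbinomial (Suc n) (Suc k) p = p ^ Suc k * qbinomial n (Suc k) p + qbinomial n k p"
proof -
  define m where "m = n - Suc k"
  have n: "n = Suc (k + m)"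
    using assms by (simp add: m_def)
  define A B X Y where "A = qpochhammer p p k" and "B = qpochhammer p p m"
    and "X = 1 - p ^ Suc k" and "Y = 1 - p ^ Suc m"
  have "A \<noteq> 0" "B \<noteq> 0"
    using qpochhammer_self_nonzero[OF p_power_neq_1] by (simp_all add: A_def B_def)
  moreover have "X \<noteq> 0" "Y \<noteq> 0"
    using p_power_neq_1[of "Suc k"] p_power_neq_1[of "Suc m"] by (auto simp: X_def Y_def)
  ultimately have split: "N * (P * Y + X) / (A * X * (B * Y)) =
      P * (N / (A * X * B)) + N / (A * (B * Y))" for N P
    by (simp add: field_simps)
  have "1 - p * p ^ n = p ^ Suc k * Y + X"
    by (simp add: n X_def Y_def algebra_simps power_add)
  moreover have "Suc n - Suc k = Suc m" "n - Suc k = m" "n - k = Suc m"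
    by (auto simp: n)
  moreover have "qpochhammer p p (Suc k) = A * X" "qpochhammer p p (Suc m) = B * Y"
    by (simp_all add: A_def B_def X_def Y_def qpochhammer_Suc)
  ultimately show ?thesis
    using split[of "qpochhammer p p n" "p ^ Suc k"]
    by (simp only: qbinomial_def qpochhammer_Suc[of p p n] A_def[symmetric] B_def[symmetric])
qed

text \<open>
  The \<open>q\<close>-Pascal rule, summed against a weight \<open>F\<close>. In this form the two ends of the range are
  settled once: \<open>qbinomial n k p\<close> is not zero for \<open>k > n\<close>, so the rule itself breaks down at the
  upper end except for \<open>p = 0\<close>.
\<close>

lemma sum_qbinomial_Suc:
  "(\<Sum>k\<le>Suc n. qbinomial (Suc n) k p * F k) =
     (\<Sum>k\<le>n. qbinomial n k p * (p ^ k * F k + F (Suc k)))"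
proof -
  have "(\<Sum>k\<le>Suc n. qbinomial (Suc n) k p * F k) =
      F 0 + (\<Sum>k<n. qbinomial (Suc n) (Suc k) p * F (Suc k)) + F (Suc n)"
    unfolding lessThan_Suc_atMost[symmetric]
    by (subst sum.lessThan_Suc_shift) (simp add: qbinomial_0 qbinomial_self)
  also have "\<dots> = F 0 + (\<Sum>k<n. qbinomial n (Suc k) p * p ^ Suc k * F (Suc k)) +
      ((\<Sum>k<n. qbinomial n k p * F (Suc k)) + F (Suc n))"
    by (simp add: qbinomial_Suc_Suc algebra_simps sum.distrib)
  also have "F 0 + (\<Sum>k<n. qbinomial n (Suc k) p * p ^ Suc k * F (Suc k)) =
      (\<Sum>k\<le>n. qbinomial n k p * p ^ k * F k)"
    unfolding lessThan_Suc_atMost[symmetric]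
    by (subst sum.lessThan_Suc_shift) (simp add: qbinomial_0)
  also have "(\<Sum>k<n. qbinomial n k p * F (Suc k)) + F (Suc n) =
      (\<Sum>k\<le>n. qbinomial n k p * F (Suc k))"
    unfolding lessThan_Suc_atMost[symmetric] by (simp add: qbinomial_self)
  finally show ?thesis
    by (simp add: algebra_simps sum.distrib)
qed

lemma qbinomial_symmetric: "k \<le> n \<Longrightarrow> qbinomial n (n - k) p = qbinomial n k p"
  by (simp add: qbinomial_def mult.commute)

text \<open>The other \<open>q\<close>-Pascal rule is the mirror image of the first under \<open>k \<mapsto> n - k\<close>.\<close>

lemma sum_qbinomial_Suc':
  "(\<Sum>k\<le>Suc n. qbinomial (Suc n) k p * F k) =
     (\<Sum>k\<le>n. qbinomial n k p * (F k + p ^ (n - k) * F (Suc k)))"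
proof -
  have "(\<Sum>k\<le>Suc n. qbinomial (Suc n) k p * F k) =
      (\<Sum>k\<le>Suc n. qbinomial (Suc n) k p * F (Suc n - k))"
    by (rule sum.reindex_bij_witness[of _ "\<lambda>k. Suc n - k" "\<lambda>k. Suc n - k"])
      (auto simp: qbinomial_symmetric simp del: diff_Suc_Suc)
  also have "\<dots> = (\<Sum>k\<le>n. qbinomial n k p * (p ^ k * F (Suc n - k) + F (Suc n - Suc k)))"
    by (rule sum_qbinomial_Suc)
  also have "\<dots> = (\<Sum>k\<le>n. qbinomial n k p * (F k + p ^ (n - k) * F (Suc k)))"
    by (rule sum.reindex_bij_witness[of _ "\<lambda>k. n - k" "\<lambda>k. n - k"])
      (auto simp: qbinomial_symmetric Suc_diff_le)
  finally show ?thesis .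
qed

lemma qbinomial_mult_qbinomial:
  "qbinomial n (k + j) p * qbinomial (k + j) k p = qbinomial n k p * qbinomial (n - k) j p"
  using qpochhammer_self_nonzero[OF p_power_neq_1] by (simp add: qbinomial_def)

section \<open>Two summation theorems\<close>

text \<open>
  The finite \<open>q\<close>-binomial theorem. The last factor \<open>1 - z p\<^sup>n\<close> of \<open>(z; p)\<^sub>n\<^sub>+\<^sub>1\<close> matches the second
  \<open>q\<close>-Pascal rule, because \<open>p ^ (n - k) p ^ (Suc k choose 2) = p\<^sup>n p ^ (k choose 2)\<close>.
\<close>

lemma qpochhammer_eq_sum:
  "qpochhammer z p n = (\<Sum>k\<le>n. qbinomial n k p * (p ^ (k choose 2) * (- z) ^ k))"
proof (induction n)
  case 0
  then show ?case
    by (simp add: qbinomial_0 numeral_2_eq_2)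
next
  case (Suc n)
  have "(\<Sum>k\<le>Suc n. qbinomial (Suc n) k p * (p ^ (k choose 2) * (- z) ^ k)) =
      (\<Sum>k\<le>n. qbinomial n k p * (p ^ (k choose 2) * (- z) ^ k +
        p ^ (n - k) * (p ^ (Suc k choose 2) * (- z) ^ Suc k)))"
    by (rule sum_qbinomial_Suc')
  also have "\<dots> = (\<Sum>k\<le>n. qbinomial n k p * (p ^ (k choose 2) * (- z) ^ k) * (1 - z * p ^ n))"
  proof (rule sum.cong[OF refl])
    fix k assume "k \<in> {..n}"
    then have "p ^ (n - k) * p ^ (Suc k choose 2) = p ^ n * p ^ (k choose 2)"
      by (simp add: numeral_2_eq_2 flip: power_add)
    then show "qbinomial n k p * (p ^ (k choose 2) * (- z) ^ k +
          p ^ (n - k) * (p ^ (Suc k choose 2) * (- z) ^ Suc k)) =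
        qbinomial n k p * (p ^ (k choose 2) * (- z) ^ k) * (1 - z * p ^ n)"
      by (simp add: algebra_simps)
  qed
  finally show ?case
    by (simp add: Suc.IH qpochhammer_Suc flip: sum_distrib_right)
qed

text \<open>
  The \<open>q\<close>-Chu-Vandermonde sum with denominators cleared. The first \<open>q\<close>-Pascal rule splits the sum
  for \<open>m + 1\<close> into \<open>v (1 - d p\<^sup>m)\<close> times the sum for \<open>m\<close> at \<open>(v, d)\<close> and \<open>1 - v\<close> times the sum for
  \<open>m\<close> at \<open>(v/p, d p)\<close>. Both have the value \<open>(v d; p)\<^sub>m\<close>, as \<open>v d\<close> is the same at both points, and
  \<open>v (1 - d p\<^sup>m) + (1 - v) = 1 - v d p\<^sup>m\<close> is the missing factor.
\<close>

lemma q_chu_vandermonde: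
  assumes "p \<noteq> 0"
  shows "(\<Sum>j\<le>m. qbinomial m j p * ((v * inverse p ^ j) ^ (m - j) *
            qpochhammer v (inverse p) j * qpochhammer (d * p ^ j) p (m - j))) =
         qpochhammer (v * d) p m"
proof (induction m arbitrary: v d)
  case 0
  then show ?case
    by (simp add: qbinomial_0)
next
  case (Suc m)
  let ?G = "\<lambda>m v d j. (v * inverse p ^ j) ^ (m - j) *
    qpochhammer v (inverse p) j * qpochhammer (d * p ^ j) p (m - j)"
  have low: "p ^ j * ?G (Suc m) v d j = v * (1 - d * p ^ m) * ?G m v d j" if "j \<le> m" for j
  proof -
    have "d * p ^ j * p ^ (m - j) = d * p ^ m"
      using that by (simp add: mult.assoc flip: power_add)
    moreover have "p ^ j * (v * inverse p ^ j) = v"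
      using \<open>p \<noteq> 0\<close> by (simp add: field_simps)
    moreover have "p ^ j * ?G (Suc m) v d j =
        (p ^ j * (v * inverse p ^ j)) * (1 - d * p ^ j * p ^ (m - j)) * ?G m v d j"
      using that by (simp add: Suc_diff_le qpochhammer_Suc mult_ac)
    ultimately show ?thesis
      by (simp only:)
  qed
  have high: "?G (Suc m) v d (Suc j) = (1 - v) * ?G m (v * inverse p) (d * p) j" for j
    by (simp add: qpochhammer_Suc_left mult_ac)
  have "(\<Sum>j\<le>Suc m. qbinomial (Suc m) j p * ?G (Suc m) v d j) =
      (\<Sum>j\<le>m. qbinomial m j p * (p ^ j * ?G (Suc m) v d j + ?G (Suc m) v d (Suc j)))"
    by (rule sum_qbinomial_Suc)
  also have "\<dots> = (\<Sum>j\<le>m. v * (1 - d * p ^ m) * (qbinomial m j p * ?G m v d j) +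
      (1 - v) * (qbinomial m j p * ?G m (v * inverse p) (d * p) j))"
    by (intro sum.cong refl, subst low, simp, subst high, simp only: ring_distribs mult_ac)
  also have "\<dots> = v * (1 - d * p ^ m) * (\<Sum>j\<le>m. qbinomial m j p * ?G m v d j) +
      (1 - v) * (\<Sum>j\<le>m. qbinomial m j p * ?G m (v * inverse p) (d * p) j)"
    by (simp only: sum.distrib sum_distrib_left)
  also have "\<dots> = v * (1 - d * p ^ m) * qpochhammer (v * d) p m +
      (1 - v) * qpochhammer (v * inverse p * (d * p)) p m"
    by (simp only: Suc.IH)
  also have "v * inverse p * (d * p) = v * d"
    using \<open>p \<noteq> 0\<close> by simp
  finally show ?case
    by (simp add: qpochhammer_Suc algebra_simps)
qed

text \<open>
  The coefficient comparison: for \<open>u = -t/q\<close>, \<open>c = q ^ (e\<^sub>1 + 1)\<close>, \<open>p = q\<^sup>a\<close>, and multiplied by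
  \<open>p ^ (k choose 2)\<close>, the left side is the coefficient of \<open>(sq)\<^sup>k\<close> in the sum over the \<open>h\<^sub>r\<close> and
  the right side the one in the sum over the \<open>f\<^sub>r\<close>. Substituting \<open>r = k + j\<close> and pulling out
  everything that depends on \<open>k\<close> alone leaves the \<open>q\<close>-Chu-Vandermonde sum.
\<close>

lemma sum_qbinomial_qbinomial:
  assumes "p \<noteq> 0" and c: "\<And>i. c * p ^ i \<noteq> 1" and "k \<le> n"
  shows "(\<Sum>r=k..n. qbinomial r k p * ((u * inverse p ^ r) ^ (n - r) * qbinomial n r p *
            (qpochhammer u (inverse p) r / qpochhammer c p r))) =
         qbinomial n k p *
           (qpochhammer (u * c) p (n - k) * qpochhammer u (inverse p) k / qpochhammer c p n)"
proof -
  define v d m where "v = u * inverse p ^ k" and "d = c * p ^ k" and "m = n - k"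
  have c_nz: "qpochhammer c p i \<noteq> 0" for i
    using c by (simp add: qpochhammer_nonzero_iff)
  have vd: "v * d = u * c"
    using \<open>p \<noteq> 0\<close> by (simp add: v_def d_def field_simps)
  have summand: "qbinomial (k + j) k p * ((u * inverse p ^ (k + j)) ^ (n - (k + j)) *
        qbinomial n (k + j) p *
        (qpochhammer u (inverse p) (k + j) / qpochhammer c p (k + j))) =
      qbinomial n k p * qpochhammer u (inverse p) k / qpochhammer c p n *
        (qbinomial m j p * ((v * inverse p ^ j) ^ (m - j) *
          qpochhammer v (inverse p) j * qpochhammer (d * p ^ j) p (m - j)))"
    if "j \<le> m" for j
  proof -
    have "n = (k + j) + (m - j)"
      using that \<open>k \<le> n\<close> by (simp add: m_def)
    then have "qpochhammer c p n = qpochhammer c p (k + j) * qpochhammer (d * p ^ j) p (m - j)"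
      by (metis qpochhammer_add d_def power_add mult.assoc)
    then have inv: "1 / qpochhammer c p (k + j) =
        qpochhammer (d * p ^ j) p (m - j) / qpochhammer c p n"
      using c_nz[of n] c_nz[of "k + j"] by (simp add: field_simps)
    have "n - (k + j) = m - j"
      by (simp add: m_def)
    moreover have "u * inverse p ^ (k + j) = v * inverse p ^ j"
      by (simp add: v_def power_add mult_ac)
    moreover have "qpochhammer u (inverse p) (k + j) =
        qpochhammer u (inverse p) k * qpochhammer v (inverse p) j"
      by (simp add: qpochhammer_add v_def)
    ultimately have "qbinomial (k + j) k p * ((u * inverse p ^ (k + j)) ^ (n - (k + j)) *
          qbinomial n (k + j) p *
          (qpochhammer u (inverse p) (k + j) / qpochhammer c p (k + j))) =
        (qbinomial n (k + j) p * qbinomial (k + j) k p) * (v * inverse p ^ j) ^ (m - j) *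
          (qpochhammer u (inverse p) k * qpochhammer v (inverse p) j) *
          (1 / qpochhammer c p (k + j))"
      by simp
    then show ?thesis
      unfolding qbinomial_mult_qbinomial inv m_def[symmetric] by (simp add: mult_ac)
  qed
  have "(\<Sum>r=k..n. qbinomial r k p * ((u * inverse p ^ r) ^ (n - r) * qbinomial n r p *
            (qpochhammer u (inverse p) r / qpochhammer c p r))) =
      (\<Sum>j\<le>m. qbinomial (k + j) k p * ((u * inverse p ^ (k + j)) ^ (n - (k + j)) *
        qbinomial n (k + j) p *
        (qpochhammer u (inverse p) (k + j) / qpochhammer c p (k + j))))"
    by (rule sum.reindex_bij_witness[of _ "\<lambda>j. k + j" "\<lambda>r. r - k"])
      (use \<open>k \<le> n\<close> in \<open>auto simp: m_def\<close>)
  also have "\<dots> = qbinomial n k p * qpochhammer u (inverse p) k / qpochhammer c p n *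
      qpochhammer (v * d) p m"
    unfolding q_chu_vandermonde[OF \<open>p \<noteq> 0\<close>, of m v d, symmetric] sum_distrib_left
    by (intro sum.cong refl summand) simp
  finally show ?thesis
    unfolding vd by (simp only: m_def times_divide_eq_left times_divide_eq_right mult_ac)
qed

end

section \<open>The identity\<close>

lemma sum_f_coeff_eq_sum_h_coeff:
  fixes q t s :: "'k::field"
  assumes "q \<noteq> 0" and q_power_neq_1: "\<And>i. i > 0 \<Longrightarrow> q ^ i \<noteq> 1" and "a > 0"
  shows "(\<Sum>r=0..n. s ^ r * f_coeff n e a r q t) =
         (\<Sum>r=0..n. qpochhammer (- s * q) (q ^ a) r * h_coeff n e a r q t)"
proof -
  define p where "p = q ^ a"
  define u where "u = - t * inverse q"
  define c where "c = q ^ (e + 1)"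
  have "p \<noteq> 0"
    using \<open>q \<noteq> 0\<close> by (simp add: p_def)
  have p_power_neq_1: "p ^ i \<noteq> 1" if "i > 0" for i
    using that \<open>a > 0\<close> q_power_neq_1[of "a * i"] by (simp add: p_def power_mult)
  have c_neq: "c * p ^ i \<noteq> 1" for i
    using q_power_neq_1[of "e + 1 + a * i"] by (simp add: c_def p_def power_add power_mult mult.assoc)
  have uc: "- t * q ^ e = u * c"
    using \<open>q \<noteq> 0\<close> by (simp add: u_def c_def)
  have p_inv: "q powi (- int a) = inverse p"
    by (simp add: p_def power_int_minus)
  have u_powi: "- t * q powi (-1) = u"
    by (simp add: u_def power_int_minus)
  have ur: "- t * q powi (- int a * int r - 1) = u * inverse p ^ r" for r
  proof -
    have "- int a * int r - 1 = - int (a * r + 1)"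
      by simp
    then have "q powi (- int a * int r - 1) = inverse (q ^ (a * r + 1))"
      by (simp only: power_int_minus power_int_of_nat)
    then show ?thesis
      by (simp add: u_def p_def power_add power_mult power_inverse mult_ac)
  qed
  define H where "H = (\<lambda>r. (u * inverse p ^ r) ^ (n - r) * qbinomial n r p *
    (qpochhammer u (inverse p) r / qpochhammer c p r))"
  have h: "h_coeff n e a r q t = H r" for r
    unfolding h_coeff_def ur p_inv u_powi H_def by (simp add: p_def c_def)
  have f: "f_coeff n e a k q t = q ^ k * p ^ (k choose 2) *
      (\<Sum>r=k..n. qbinomial r k p * H r)" if "k \<le> n" for k
  proof -
    have "q ^ (k + a * (k choose 2)) = q ^ k * p ^ (k choose 2)"
      by (simp add: p_def power_add power_mult)
    moreover have "(\<Sum>r=k..n. qbinomial r k p * H r) = qbinomial n k p *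
        (qpochhammer (u * c) p (n - k) * qpochhammer u (inverse p) k / qpochhammer c p n)"
      unfolding H_def by (rule sum_qbinomial_qbinomial[OF p_power_neq_1 \<open>p \<noteq> 0\<close> c_neq that])
    ultimately show ?thesis
      unfolding f_coeff_def p_inv u_powi uc
      by (simp only: p_def[symmetric] c_def[symmetric] mult.assoc)
  qed
  have expand: "qpochhammer (- s * q) p r =
      (\<Sum>k\<le>r. qbinomial r k p * (p ^ (k choose 2) * (s * q) ^ k))" for r
    using qpochhammer_eq_sum[OF p_power_neq_1, of "- s * q" r] by simp
  have "(\<Sum>r=0..n. qpochhammer (- s * q) (q ^ a) r * h_coeff n e a r q t) =
      (\<Sum>r=0..n. \<Sum>k=0..r. (s * q) ^ k * p ^ (k choose 2) * (qbinomial r k p * H r))"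
    unfolding h p_def[symmetric] expand sum_distrib_right
    by (simp add: mult_ac atLeast0AtMost)
  also have "\<dots> = (\<Sum>k=0..n. \<Sum>r=k..n. (s * q) ^ k * p ^ (k choose 2) * (qbinomial r k p * H r))"
    by (simp add: sum.Sigma,
        rule sum.reindex_bij_witness[of _ "\<lambda>(k, r). (r, k)" "\<lambda>(r, k). (k, r)"]) auto
  also have "\<dots> = (\<Sum>k=0..n. s ^ k * f_coeff n e a k q t)"
    by (intro sum.cong refl) (simp add: f power_mult_distrib mult.assoc flip: sum_distrib_left)
  finally show ?thesis ..
qed

lemma q_var_power: "q_var ^ k = Fract [:[:[:0, 1:] ^ k:]:] 1"
  by (induction k) (simp_all add: q_var_def One_fract_def flip: one_pCons)

lemma q_var_power_neq_1:
  assumes "k > 0"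
  shows "q_var ^ k \<noteq> 1"
proof
  assume "q_var ^ k = 1"
  then have "[:0, 1:] ^ k = (1 :: rat poly)"
    by (simp add: q_var_power One_fract_def eq_fract one_pCons)
  then have "degree ([:0, 1:] ^ k :: rat poly) = 0"
    by simp
  with assms show False
    by (simp add: degree_power_eq)
qed

theorem theorem1p5:
  fixes W :: "(complex ^ 'n ^ 'n) set" and e\<^sub>1 a :: nat
  assumes "coincidental_group W"
    and "arithmetic_exponents W e\<^sub>1 a"
  shows "(\<Sum>r=0..CARD('n). s_var ^ r * f_coeff CARD('n) e\<^sub>1 a r q_var t_var) =
         (\<Sum>r=0..CARD('n). qpochhammer (- s_var * q_var) (q_var ^ a) r *
                            h_coeff CARD('n) e\<^sub>1 a r q_var t_var)"
proof (rule sum_f_coeff_eq_sum_h_coeff)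
  show "q_var \<noteq> 0"
    by (simp add: q_var_def Zero_fract_def eq_fract)
  show "q_var ^ i \<noteq> 1" if "i > 0" for i
    using that by (rule q_var_power_neq_1)
  show "a > 0"
    using assms(2) by (simp add: arithmetic_exponents_def)
qed

end
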